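(* For $n\ge0$ let $T^A_n(x,y)=\sum_{i,j\ge0}T^A(n,i,j)x^iy^j$, where $T^A(n,i,j)$ is the number of alternating permutations of $[n]$ with $i$ exterior peaks of pattern 132 and $j$ exterior peaks of pattern 231. Then $$\sum_{n=0}^\infty T^A_n(x,y)\frac{t^n}{n!}=\frac{e^{\frac{x-y}{2}t^2}\left(1+t\,{}_1F_1\left(\frac{x}{2(x-y)};\frac32;-\frac{x-y}{2}t^2\right)\right)}{{}_1F_1\left(-\frac{y}{2(x-y)};\frac12;\frac{x-y}{2}t^2\right)}.$$
   Context: A permutation $\pi=\pi_1\cdots\pi_n$ of $[n]=\{1,\dots,n\}$ is alternating if $\pi_1>\pi_2<\pi_3>\pi_4<\cdots$ (for $n\le 1$ the unique permutation is alternating). Put $\pi_0=0$. An index $1\le i\le n-1$ is an exterior peak if $\pi_{i-1}<\pi_i>\pi_{i+1}$; it is of pattern 132 if moreover $\pi_{i-1}<\pi_{i+1}$, and of pattern 231 if moreover $\pi_{i-1}>\pi_{i+1}$. With $(a)_0=1$ and $(a)_n=a(a+1)\cdots(a+n-1)$, the confluent hypergeometric function is ${}_1F_1(a;b;z)=\sum_{n\ge0}\frac{(a)_n}{(b)_n}\frac{z^n}{n!}$. The identity is one of formal power series in $t$ with coefficients in the field $\mathbb{Q}(x,y)$ of rational functions. *)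

theory Defs
  imports
    "HOL-Computational_Algebra.Computational_Algebra"
    "HOL-Combinatorics.Permutations"
begin

text \<open>
  A permutation of $[n]$ is a function \<open>p\<close> with \<open>p permutes {1..n}\<close>, so that
  \<open>p k\<close> is $\pi_k$. As such a function fixes everything outside \<open>{1..n}\<close>, the
  convention $\pi_0 = 0$ holds automatically.
\<close>

definition alternating_perm :: "nat \<Rightarrow> (nat \<Rightarrow> nat) \<Rightarrow> bool" where
  "alternating_perm n p \<longleftrightarrow> p permutes {1..n} \<and>
     (\<forall>i. 1 \<le> i \<and> i < n \<longrightarrow> (if odd i then p i > p (i + 1) else p i < p (i + 1)))"

definition exterior_peaks :: "nat \<Rightarrow> (nat \<Rightarrow> nat) \<Rightarrow> nat set" where
  "exterior_peaks n p = {i. 1 \<le> i \<and> i < n \<and> p (i - 1) < p i \<and> p i > p (i + 1)}"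

definition exterior_peaks_132 :: "nat \<Rightarrow> (nat \<Rightarrow> nat) \<Rightarrow> nat set" where
  "exterior_peaks_132 n p = {i \<in> exterior_peaks n p. p (i - 1) < p (i + 1)}"

definition exterior_peaks_231 :: "nat \<Rightarrow> (nat \<Rightarrow> nat) \<Rightarrow> nat set" where
  "exterior_peaks_231 n p = {i \<in> exterior_peaks n p. p (i - 1) > p (i + 1)}"

definition TA :: "nat \<Rightarrow> nat \<Rightarrow> nat \<Rightarrow> nat" where
  "TA n i j = card {p. alternating_perm n p \<and>
     card (exterior_peaks_132 n p) = i \<and> card (exterior_peaks_231 n p) = j}"

lemma permutes_at_0: "p permutes {1..n} \<Longrightarrow> p 0 = (0::nat)"
  by (simp add: permutes_not_in)

lemma card_exterior_peaks_le:
  "card (exterior_peaks_132 n p) \<le> n" "card (exterior_peaks_231 n p) \<le> n"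
proof -
  have "exterior_peaks_132 n p \<subseteq> {1..n}" "exterior_peaks_231 n p \<subseteq> {1..n}"
    by (auto simp: exterior_peaks_132_def exterior_peaks_231_def exterior_peaks_def)
  then show "card (exterior_peaks_132 n p) \<le> n" "card (exterior_peaks_231 n p) \<le> n"
    using card_mono[of "{1..n}"] by fastforce+
qed

text \<open>The following lemma justifies summing only over \<open>i, j \<le> n\<close> in the generating polynomial.\<close>

lemma TA_eq_0:
  assumes "i > n \<or> j > n"
  shows "TA n i j = 0"
proof -
  have "{p. alternating_perm n p \<and>
     card (exterior_peaks_132 n p) = i \<and> card (exterior_peaks_231 n p) = j} = {}"
    using assms card_exterior_peaks_le[of n] by (auto simp: not_le[symmetric])
  then show ?thesis by (simp only: TA_def card.empty)
qed

definition TA_poly :: "nat \<Rightarrow> 'a::comm_semiring_1 \<Rightarrow> 'a \<Rightarrow> 'a" where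
  "TA_poly n x y = (\<Sum>i\<le>n. \<Sum>j\<le>n. of_nat (TA n i j) * x ^ i * y ^ j)"

text \<open>
  The field $\mathbb{Q}(x,y)$ is the fraction field of $\mathbb{Q}[x][y]$: the indeterminate
  of the inner polynomial ring is $x$, that of the outer one is $y$.
\<close>

type_synonym ratfun_xy = "rat poly poly fract"

definition var_x :: ratfun_xy where
  "var_x = to_fract [:[:0, 1:]:]"

definition var_y :: ratfun_xy where
  "var_y = to_fract [:0, 1:]"

text \<open>
  Exponential and confluent hypergeometric function of a formal power series \<open>z\<close>,
  meaningful if \<open>z\<close> has constant term 0.
\<close>

definition exp_fps :: "'a::field_char_0 fps \<Rightarrow> 'a fps" where
  "exp_fps z = fps_exp 1 oo z"

definition hypergeo_1F1 :: "'a::field_char_0 \<Rightarrow> 'a \<Rightarrow> 'a fps \<Rightarrow> 'a fps" where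
  "hypergeo_1F1 a b z = fps_hypergeo [a] [b] 1 oo z"

lemma hypergeo_1F1_series:
  "hypergeo_1F1 a b z =
     Abs_fps (\<lambda>n. pochhammer a n / pochhammer b n / fact n) oo z"
proof -
  have "fps_hypergeo [a] [b] 1 = Abs_fps (\<lambda>n. pochhammer a n / pochhammer b n / fact n)"
    by (simp add: fps_eq_iff)
  then show ?thesis
    by (simp add: hypergeo_1F1_def)
qed

end

theory Submission
  imports Defs "HOL-Combinatorics.Multiset_Permutations"
begin

text \<open>
  Weight every alternating permutation by $x$ for each exterior peak of pattern 132 and by $y$ for
  each one of pattern 231, and cut it at its smallest entry: $\pi = \sigma\, 1\, \tau$. If
  $\pi$ has length at least 2, the entry 1 must be a valley, so $\sigma$ has odd length and ends in an
  exterior peak of $\pi$ that is not one of $\sigma$. This extra peak has pattern 231 when it has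
  a left neighbour in $\sigma$, since the entry 1 on its right is smaller; it has pattern 132 only
  when $\sigma$ is a single entry, whose left neighbour is $\pi_0 = 0$. In $\tau$ the preceding
  entry 1 plays the part of $\pi_0$. Summing over the set of entries of $\sigma$ gives a binomial
  recurrence (\<open>TA_poly_Suc\<close>). For the parts $E$ and $O$ of the exponential
  generating function that are even and odd in $t$, and with $d = x - y$, it reads
  (\<open>TA_egf_ode\<close>)
  $$E' = (d t + y O) E, \qquad O' = 1 + (d t + y O) O.$$

  The Riccati equation for $O$ is linearised by the usual substitution $H' = -y\,O\,H$, which turns
  it into $H'' = d t H' - y H$. The confluent hypergeometric series in the denominator is the even
  solution of this equation. Put $K = e^{d t^2/2}$ and let $N$ be $t$ times the hypergeometric
  series in the numerator; it satisfies $N'' = -d t N' - y N$. Then $K N'$ also solves the equation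
  for $H$, with the same initial values, so $H = K N'$ (an instance of Kummer's transformation in
  disguise), whence $H' = -y K N$. It follows that $K N/H$ and $K/H$ satisfy the equations for $O$
  and $E$, and these determine the two series (\<open>TA_egf_closed_form\<close>).
\<close>

section \<open>Alternating permutations as weighted lists\<close>

text \<open>
  The parameter \<open>p\<close> is the valley that precedes the list. Consuming a peak and the next
  valley together makes the weight multiplicative, and the value 0 on lists that violate the
  alternation lets sums range over all arrangements of a set. A last entry with no right
  neighbour is not an exterior peak and contributes 1.
\<close>
fun peak_weight :: "'a \<Rightarrow> 'a \<Rightarrow> nat \<Rightarrow> nat list \<Rightarrow> 'a::comm_semiring_1" where
  "peak_weight x y p [] = 1"
| "peak_weight x y p [a] = (if p < a then 1 else 0)"
| "peak_weight x y p (a # b # r) =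
     (if p < a \<and> b < a then (if p < b then x else y) * peak_weight x y b r else 0)"

text \<open>
  The link between the recursive weight and the peak sets: after an even position \<open>a\<close>, the
  next peak can only be \<open>Suc a\<close>, and position \<open>a + 2\<close> is a valley. Injectivity
  rules out a tie between the two neighbours of a peak, which would have neither pattern.
\<close>
lemma peak_weight_permutation_suffix:
  assumes "inj p" "even a" "a \<le> n"
  shows "peak_weight x y (p a) (map p [Suc a..<Suc n]) =
    (if \<forall>i. a \<le> i \<and> i < n \<longrightarrow> (if even i then p i < p (i + 1) else p i > p (i + 1))
     then x ^ card {i \<in> exterior_peaks_132 n p. a < i} *
          y ^ card {i \<in> exterior_peaks_231 n p. a < i}
     else 0)"
  using assms(2,3)
proof (induction "n - a" arbitrary: a rule: less_induct)
  case less
  define alt where "alt = (\<lambda>a. \<forall>i. a \<le> i \<and> i < n \<longrightarrow>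
    (if even i then p i < p (i + 1) else p i > p (i + 1)))"
  define P where "P = (\<lambda>a. {i \<in> exterior_peaks_132 n p. a < i})"
  define Q where "Q = (\<lambda>a. {i \<in> exterior_peaks_231 n p. a < i})"
  have fin: "finite (P b)" "finite (Q b)" for b
    by (rule finite_subset[of _ "{..n}"];
        force simp: P_def Q_def exterior_peaks_132_def exterior_peaks_231_def exterior_peaks_def)+
  have empty: "P b = {}" "Q b = {}" if "n \<le> Suc b" for b
    using that
    by (auto simp: P_def Q_def exterior_peaks_132_def exterior_peaks_231_def exterior_peaks_def)
  have "peak_weight x y (p a) (map p [Suc a..<Suc n]) =
    (if alt a then x ^ card (P a) * y ^ card (Q a) else 0)"
  proof -
    consider "a = n" | "n = Suc a" | "Suc (Suc a) \<le> n"
      using less.prems by linarith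
    then show ?thesis
    proof cases
      case 1
      then show ?thesis using empty[of a] by (simp add: alt_def)
    next
      case 2
      have "alt a \<longleftrightarrow> p a < p (Suc a)"
        using 2 less.prems by (auto simp: alt_def less_Suc_eq)
      then show ?thesis using 2 empty[of a] by simp
    next
      case 3
      let ?b = "Suc (Suc a)"
      have list: "[Suc a..<Suc n] = Suc a # ?b # [Suc ?b..<Suc n]"
        using 3 by (simp add: upt_conv_Cons)
      have alt_step: "alt a \<longleftrightarrow> p a < p (Suc a) \<and> p ?b < p (Suc a) \<and> alt ?b"
      proof
        assume *: "alt a"
        from * have "p a < p (Suc a)" using 3 less.prems unfolding alt_def by (auto dest: spec[of _ a])
        moreover from * have "p ?b < p (Suc a)"
          using 3 less.prems unfolding alt_def by (auto dest: spec[of _ "Suc a"])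
        moreover from * have "alt ?b" unfolding alt_def by (meson Suc_leD)
        ultimately show "p a < p (Suc a) \<and> p ?b < p (Suc a) \<and> alt ?b" by blast
      next
        assume *: "p a < p (Suc a) \<and> p ?b < p (Suc a) \<and> alt ?b"
        show "alt a" unfolding alt_def
        proof (intro allI impI)
          fix i assume i: "a \<le> i \<and> i < n"
          then consider "i = a" | "i = Suc a" | "?b \<le> i" by linarith
          then show "if even i then p i < p (i + 1) else p (i + 1) < p i"
          proof cases
            case 3
            then show ?thesis using * i unfolding alt_def by blast
          qed (use * less.prems in auto)
        qed
      qed
      have neq: "p a \<noteq> p ?b" using \<open>inj p\<close> by (auto simp: inj_eq)
      have PQ: "P a = (if p a < p ?b then insert (Suc a) (P ?b) else P ?b)"
               "Q a = (if p a < p ?b then Q ?b else insert (Suc a) (Q ?b))"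
        if "p a < p (Suc a)" "p ?b < p (Suc a)"
      proof -
        have *: "a < i \<longleftrightarrow> i = Suc a \<or> i = ?b \<or> ?b < i" for i by auto
        have "?b \<notin> exterior_peaks n p" using that by (auto simp: exterior_peaks_def)
        moreover have "Suc a \<in> exterior_peaks n p" using that 3 by (auto simp: exterior_peaks_def)
        ultimately show "P a = (if p a < p ?b then insert (Suc a) (P ?b) else P ?b)"
               "Q a = (if p a < p ?b then Q ?b else insert (Suc a) (Q ?b))"
          using neq unfolding P_def Q_def exterior_peaks_132_def exterior_peaks_231_def *
          by auto
      qed
      have nin: "Suc a \<notin> P ?b" "Suc a \<notin> Q ?b" by (auto simp: P_def Q_def)
      have IH: "peak_weight x y (p ?b) (map p [Suc ?b..<Suc n]) =
        (if alt ?b then x ^ card (P ?b) * y ^ card (Q ?b) else 0)"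
        unfolding alt_def P_def Q_def
        by (rule less.hyps) (use 3 less.prems in auto)
      show ?thesis
        unfolding list list.map peak_weight.simps IH alt_step
        using PQ fin nin by (auto simp: mult_ac)
    qed
  qed
  then show ?case by (simp only: alt_def P_def Q_def)
qed

lemma bij_betw_permutes_lists:
  "bij_betw (\<lambda>p. map p [1..<Suc n]) {p. p permutes {1..n}} (permutations_of_set {1..n})"
proof -
  let ?f = "\<lambda>p::nat \<Rightarrow> nat. map p [1..<Suc n]"
  have inj: "inj_on ?f {p. p permutes {1..n}}"
  proof (rule inj_onI)
    fix p q assume pq: "p \<in> {p. p permutes {1..n}}" "q \<in> {p. p permutes {1..n}}" "?f p = ?f q"
    show "p = q"
    proof
      fix k
      show "p k = q k"
      proof (cases "k \<in> {1..n}")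
        case True
        then show ?thesis using pq(3) by (auto simp: map_eq_conv)
      next
        case False
        then show ?thesis using pq(1,2) by (simp add: permutes_not_in)
      qed
    qed
  qed
  have sub: "?f ` {p. p permutes {1..n}} \<subseteq> permutations_of_set {1..n}"
  proof clarify
    fix p assume p: "p permutes {1..n}"
    have "p ` {1..n} = {1..n}" using p by (rule permutes_image)
    moreover have "set [1..<Suc n] = {1..n}" by auto
    ultimately have "set (?f p) = {1..n}" unfolding set_map by simp
    moreover have "inj_on p (set [1..<Suc n])" using p by (auto intro: permutes_inj_on)
    then have "distinct (?f p)" by (simp add: distinct_map del: upt_Suc)
    ultimately show "?f p \<in> permutations_of_set {1..n}" by (rule permutations_of_setI)
  qed
  \<comment> \<open>Surjectivity by counting: both sets have \<open>fact n\<close> elements.\<close>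
  have "card (?f ` {p. p permutes {1..n}}) = card (permutations_of_set {1..n})"
    using inj by (simp add: card_image card_permutations)
  then have "?f ` {p. p permutes {1..n}} = permutations_of_set {1..n}"
    using sub by (intro card_subset_eq) auto
  with inj show ?thesis by (simp add: bij_betw_def)
qed

lemma TA_poly_eq_sum_alternating:
  "TA_poly n x y = (\<Sum>p | alternating_perm n p.
     x ^ card (exterior_peaks_132 n p) * y ^ card (exterior_peaks_231 n p))"
proof -
  let ?A = "{p. alternating_perm n p}"
  let ?c = "\<lambda>p. (card (exterior_peaks_132 n p), card (exterior_peaks_231 n p))"
  have fin: "finite ?A"
    by (rule finite_subset[OF _ finite_permutations[of "{1..n}"]]) (auto simp: alternating_perm_def)
  have "(\<Sum>p\<in>?A. x ^ card (exterior_peaks_132 n p) * y ^ card (exterior_peaks_231 n p)) =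
    (\<Sum>ij\<in>{..n}\<times>{..n}. \<Sum>p | p \<in> ?A \<and> ?c p = ij.
      x ^ card (exterior_peaks_132 n p) * y ^ card (exterior_peaks_231 n p))"
    by (rule sum.group[symmetric]) (use fin card_exterior_peaks_le in auto)
  also have "\<dots> = (\<Sum>ij\<in>{..n}\<times>{..n}. \<Sum>p | p \<in> ?A \<and> ?c p = ij. x ^ fst ij * y ^ snd ij)"
    by (intro sum.cong refl) auto
  also have "\<dots> = (\<Sum>ij\<in>{..n}\<times>{..n}. of_nat (TA n (fst ij) (snd ij)) * x ^ fst ij * y ^ snd ij)"
    by (intro sum.cong refl) (auto simp: TA_def mult_ac)
  also have "\<dots> = TA_poly n x y"
    by (simp add: TA_poly_def sum.cartesian_product case_prod_unfold)
  finally show ?thesis ..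
qed

definition perm_weight :: "'a \<Rightarrow> 'a \<Rightarrow> nat set \<Rightarrow> 'a::comm_semiring_1" where
  "perm_weight x y S = (\<Sum>xs\<in>permutations_of_set S. peak_weight x y 0 xs)"

text \<open>
  Starting the suffix formula at position 0 demands the ascent $\pi_0 < \pi_1$ in addition to
  alternation; it holds because all entries of $\pi$ are positive.
\<close>
lemma TA_poly_eq_perm_weight: "TA_poly n x y = perm_weight x y {1..n}"
proof -
  have "perm_weight x y {1..n} =
      (\<Sum>p | p permutes {1..n}. peak_weight x y 0 (map p [1..<Suc n]))"
    unfolding perm_weight_def
    by (rule sum.reindex_bij_betw[OF bij_betw_permutes_lists, symmetric])
  also have "\<dots> = (\<Sum>p | p permutes {1..n}. if alternating_perm n p then
      x ^ card (exterior_peaks_132 n p) * y ^ card (exterior_peaks_231 n p) else 0)"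
  proof (rule sum.cong[OF refl])
    fix p assume "p \<in> {p. p permutes {1..n}}"
    then have p: "p permutes {1..n}" by simp
    have p0: "p 0 = 0" using p by (rule permutes_at_0)
    have pos: "0 < p (Suc 0)" if "0 < n"
      using permutes_inj[OF p] p0 by (metis injD neq0_conv zero_neq_one One_nat_def)
    have alt: "alternating_perm n p \<longleftrightarrow>
      (\<forall>i. 0 \<le> i \<and> i < n \<longrightarrow> (if even i then p i < p (i + 1) else p i > p (i + 1)))"
    proof
      assume *: "alternating_perm n p"
      show "\<forall>i. 0 \<le> i \<and> i < n \<longrightarrow> (if even i then p i < p (i + 1) else p i > p (i + 1))"
      proof (intro allI impI)
        fix i assume i: "0 \<le> i \<and> i < n"
        from * have "1 \<le> i \<and> i < n \<longrightarrow> (if odd i then p i > p (i + 1) else p i < p (i + 1))"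
          unfolding alternating_perm_def by blast
        then show "if even i then p i < p (i + 1) else p i > p (i + 1)"
          using i pos p0 by (cases "i = 0"; cases "even i") (simp_all add: Suc_le_eq)
      qed
    next
      assume "\<forall>i. 0 \<le> i \<and> i < n \<longrightarrow> (if even i then p i < p (i + 1) else p i > p (i + 1))"
      then show "alternating_perm n p" using p unfolding alternating_perm_def by auto
    qed
    have "0 \<notin> exterior_peaks n p" by (simp add: exterior_peaks_def)
    then have sets: "{i \<in> exterior_peaks_132 n p. 0 < i} = exterior_peaks_132 n p"
      "{i \<in> exterior_peaks_231 n p. 0 < i} = exterior_peaks_231 n p"
      by (auto simp: exterior_peaks_132_def exterior_peaks_231_def intro: gr0I)
    show "peak_weight x y 0 (map p [1..<Suc n]) = (if alternating_perm n p then
        x ^ card (exterior_peaks_132 n p) * y ^ card (exterior_peaks_231 n p) else 0)"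
      using peak_weight_permutation_suffix[OF permutes_inj[OF p], of 0 n x y]
      unfolding alt sets p0 by simp
  qed
  also have "\<dots> = TA_poly n x y"
  proof -
    have "p permutes {1..n}" if "alternating_perm n p" for p
      using that by (simp add: alternating_perm_def)
    then show ?thesis
      unfolding TA_poly_eq_sum_alternating
      by (intro sum.mono_neutral_cong_right) (auto simp: finite_permutations)
  qed
  finally show ?thesis ..
qed

section \<open>Cutting at the smallest entry\<close>

lemma sum_permutations_split:
  assumes "finite S" "m \<notin> S"
  shows "(\<Sum>xs\<in>permutations_of_set (insert m S). g xs) =
    (\<Sum>B\<in>Pow S. \<Sum>u\<in>permutations_of_set B. \<Sum>v\<in>permutations_of_set (S - B). g (u @ m # v))"
proof -
  let ?I = "SIGMA B:Pow S. permutations_of_set B \<times> permutations_of_set (S - B)"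
  let ?j = "\<lambda>xs. (set (takeWhile (\<lambda>a. a \<noteq> m) xs), takeWhile (\<lambda>a. a \<noteq> m) xs,
                   tl (dropWhile (\<lambda>a. a \<noteq> m) xs))"
  have tw: "takeWhile (\<lambda>a. a \<noteq> m) (u @ m # v) = u" "dropWhile (\<lambda>a. a \<noteq> m) (u @ m # v) = m # v"
    if "m \<notin> set u" for u v :: "'a list"
    using that by (induction u) auto
  have "(\<Sum>xs\<in>permutations_of_set (insert m S). g xs) = (\<Sum>(B, u, v)\<in>?I. g (u @ m # v))"
  proof (rule sum.reindex_bij_witness[of _ "\<lambda>(B, u, v). u @ m # v" ?j])
    fix xs assume "xs \<in> permutations_of_set (insert m S)"
    then have xs: "set xs = insert m S" "distinct xs" by (auto dest: permutations_of_setD)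
    then obtain u v where uv: "xs = u @ m # v" using split_list[of m xs] by auto
    then have "m \<notin> set u" using xs by simp
    then have j: "?j xs = (set u, u, v)" unfolding uv using tw by simp
    show "(case ?j xs of (B, u, v) \<Rightarrow> u @ m # v) = xs"
      unfolding j using uv by simp
    have "set u \<union> set v = S" "set u \<inter> set v = {}" "distinct u" "distinct v"
      using xs uv assms(2) by auto
    then show "?j xs \<in> ?I" unfolding j by (auto simp: permutations_of_set_def)
    show "(case ?j xs of (B, u, v) \<Rightarrow> g (u @ m # v)) = g xs"
      unfolding j using uv by simp
  next
    fix Buv assume "Buv \<in> ?I"
    then obtain B u v where *: "Buv = (B, u, v)" "B \<subseteq> S" "set u = B" "distinct u"
      "set v = S - B" "distinct v"
      by (auto simp: permutations_of_set_def)
    then have "m \<notin> set u" "m \<notin> set v" using assms(2) by auto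
    then show "?j (case Buv of (B, u, v) \<Rightarrow> u @ m # v) = Buv" using * tw by simp
    show "(case Buv of (B, u, v) \<Rightarrow> u @ m # v) \<in> permutations_of_set (insert m S)"
      using * \<open>m \<notin> set u\<close> \<open>m \<notin> set v\<close> by (auto simp: permutations_of_set_def)
  qed
  also have "\<dots> = (\<Sum>B\<in>Pow S. \<Sum>(u, v)\<in>permutations_of_set B \<times> permutations_of_set (S - B).
      g (u @ m # v))"
    using assms(1) by (subst sum.Sigma[symmetric]) (auto simp: finite_subset)
  also have "\<dots> = (\<Sum>B\<in>Pow S. \<Sum>u\<in>permutations_of_set B. \<Sum>v\<in>permutations_of_set (S - B).
      g (u @ m # v))"
    by (simp add: sum.cartesian_product)
  finally show ?thesis .
qed

lemma peak_weight_smaller_start: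
  assumes "\<forall>a\<in>set xs. p < a" "\<forall>a\<in>set xs. q < a"
  shows "peak_weight x y p xs = peak_weight x y q xs"
  using assms by (cases "(x, y, p, xs)" rule: peak_weight.cases) auto

text \<open>
  After an even number of entries the minimum \<open>m\<close> stands at a position where an ascent
  into it would be required.
\<close>
lemma peak_weight_append_min_even:
  assumes "m < p" "\<forall>a\<in>set u. m < a" "even (length u)"
  shows "peak_weight x y p (u @ m # v) = 0"
  using assms
proof (induction x y p u rule: peak_weight.induct)
  case (1 x y p)
  then show ?case by (cases v) auto
qed auto

text \<open>
  The factor \<open>y\<close> belongs to the last entry of \<open>u\<close>, which becomes a peak with right
  neighbour \<open>m\<close>. As \<open>m < p\<close>, it has pattern 231 even when it is the only entry of
  \<open>u\<close>.
\<close>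
lemma peak_weight_append_min_odd:
  assumes "m < p" "\<forall>a\<in>set u. m < a" "odd (length u)"
  shows "peak_weight x y p (u @ m # v) = peak_weight x y p u * y * peak_weight x y m v"
  using assms
  by (induction x y p u rule: peak_weight.induct) (auto simp: mult_ac)

text \<open>
  Here the preceding valley \<open>p\<close> lies below the minimum \<open>m\<close>, as $\pi_0$ does. Hence
  the last entry of \<open>u\<close> is a peak of pattern 132 if it is the only one, and otherwise has
  its left neighbour in \<open>u\<close>, above \<open>m\<close>, and is of pattern 231.
\<close>
lemma peak_weight_split_min:
  assumes "p < m" "\<forall>a\<in>set u. m < a" "\<forall>a\<in>set v. m < a" "u \<noteq> [] \<or> v \<noteq> []"
  shows "peak_weight x y p (u @ m # v) =
    (if odd (length u) then (if length u = 1 then x else y * peak_weight x y p u) * peak_weight x y p v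
     else 0)"
proof -
  have v: "peak_weight x y m v = peak_weight x y p v"
    using assms by (intro peak_weight_smaller_start) auto
  consider "u = []" | a where "u = [a]" | a b r where "u = a # b # r"
    by (metis list.exhaust)
  then show ?thesis
  proof cases
    case 1
    then show ?thesis using assms by (cases v) auto
  next
    case 2
    then show ?thesis using assms v by auto
  next
    case 3
    have "m < b" "\<forall>a\<in>set r. m < a" using assms 3 by auto
    then have "peak_weight x y b (r @ m # v) =
        (if odd (length r) then peak_weight x y b r * y * peak_weight x y m v else 0)"
      using peak_weight_append_min_even[of m b r] peak_weight_append_min_odd[of m b r] by auto
    then show ?thesis using 3 v by (auto simp: mult_ac)
  qed
qed

lemma perm_weight_insert_min:
  assumes "finite S" "S \<noteq> {}" "0 < m" "\<forall>a\<in>S. m < a"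
  shows "perm_weight x y (insert m S) =
    (\<Sum>B\<in>Pow S. if odd (card B)
       then (if card B = 1 then x else y * perm_weight x y B) * perm_weight x y (S - B) else 0)"
proof -
  have "m \<notin> S" using assms by auto
  then have "perm_weight x y (insert m S) = (\<Sum>B\<in>Pow S. \<Sum>u\<in>permutations_of_set B.
      \<Sum>v\<in>permutations_of_set (S - B). peak_weight x y 0 (u @ m # v))"
    unfolding perm_weight_def using assms(1) by (intro sum_permutations_split)
  also have "\<dots> = (\<Sum>B\<in>Pow S. if odd (card B)
       then (if card B = 1 then x else y * perm_weight x y B) * perm_weight x y (S - B) else 0)"
  proof (rule sum.cong[OF refl])
    fix B assume "B \<in> Pow S"
    then have B: "B \<subseteq> S" "finite B" using assms(1) finite_subset by auto
    let ?w = "\<lambda>u. if card B = 1 then x else y * peak_weight x y 0 u"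
    have "(\<Sum>u\<in>permutations_of_set B. \<Sum>v\<in>permutations_of_set (S - B).
        peak_weight x y 0 (u @ m # v)) =
      (\<Sum>u\<in>permutations_of_set B. \<Sum>v\<in>permutations_of_set (S - B).
        if odd (card B) then ?w u * peak_weight x y 0 v else 0)"
    proof (intro sum.cong refl)
      fix u v assume "u \<in> permutations_of_set B" "v \<in> permutations_of_set (S - B)"
      then have uv: "set u = B" "set v = S - B" "length u = card B"
        by (auto dest: permutations_of_setD length_finite_permutations_of_set)
      then have "u \<noteq> [] \<or> v \<noteq> []" using assms(2) B by auto
      then show "peak_weight x y 0 (u @ m # v) =
          (if odd (card B) then ?w u * peak_weight x y 0 v else 0)"
        using peak_weight_split_min[of 0 m u v x y] assms B uv by (auto simp: subset_iff)
    qed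
    also have "\<dots> = (if odd (card B)
        then (\<Sum>u\<in>permutations_of_set B. ?w u) * perm_weight x y (S - B) else 0)"
      by (simp add: perm_weight_def sum_product)
    also have "(\<Sum>u\<in>permutations_of_set B. ?w u) =
        (if card B = 1 then x else y * perm_weight x y B)"
      using B by (auto simp: perm_weight_def sum_distrib_left)
    finally show "(\<Sum>u\<in>permutations_of_set B. \<Sum>v\<in>permutations_of_set (S - B).
        peak_weight x y 0 (u @ m # v)) = (if odd (card B)
          then (if card B = 1 then x else y * perm_weight x y B) * perm_weight x y (S - B) else 0)"
      by simp
  qed
  finally show ?thesis .
qed

lemma sum_Pow_card:
  fixes g :: "nat \<Rightarrow> 'a::comm_semiring_1"
  assumes "finite S"
  shows "(\<Sum>B\<in>Pow S. g (card B)) = (\<Sum>k\<le>card S. of_nat (card S choose k) * g k)"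
proof -
  have "(\<Sum>B\<in>Pow S. g (card B)) = (\<Sum>k\<le>card S. \<Sum>B | B \<in> Pow S \<and> card B = k. g (card B))"
    using assms by (intro sum.group[symmetric]) (auto simp: card_mono)
  also have "\<dots> = (\<Sum>k\<le>card S. of_nat (card S choose k) * g k)"
    using n_subsets[OF assms] by (intro sum.cong refl) simp
  finally show ?thesis .
qed

text \<open>
  That the weight of a set depends only on its cardinality enters as the hypothesis
  \<open>smaller\<close>, because this recurrence serves as the induction step that proves it.
\<close>
lemma perm_weight_insert_min_card:
  fixes x y :: "'a::comm_semiring_1"
  assumes "finite S" "card S = n" "0 < m" "\<forall>a\<in>S. m < a"
    and smaller: "\<And>B. B \<subseteq> S \<Longrightarrow> perm_weight x y B = perm_weight x y {1..card B}"
  shows "perm_weight x y (insert m S) = (if n = 0 then 1 else 0) +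
    (\<Sum>k\<le>n. of_nat (n choose k) * (if odd k
       then (if k = 1 then x else y * perm_weight x y {1..k}) * perm_weight x y {1..n - k}
       else 0))"
proof (cases "S = {}")
  case True
  then show ?thesis using assms(2,3) by (auto simp: perm_weight_def)
next
  case False
  have "perm_weight x y (insert m S) =
    (\<Sum>B\<in>Pow S. if odd (card B)
       then (if card B = 1 then x else y * perm_weight x y B) * perm_weight x y (S - B) else 0)"
    using assms False by (intro perm_weight_insert_min)
  also have "\<dots> = (\<Sum>B\<in>Pow S. if odd (card B)
       then (if card B = 1 then x else y * perm_weight x y {1..card B}) *
            perm_weight x y {1..n - card B} else 0)"
  proof (rule sum.cong[OF refl])
    fix B assume "B \<in> Pow S"
    then have "B \<subseteq> S" "card (S - B) = n - card B"
      using assms(1,2) by (auto simp: card_Diff_subset finite_subset)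
    then show "(if odd (card B)
       then (if card B = 1 then x else y * perm_weight x y B) * perm_weight x y (S - B) else 0) =
      (if odd (card B) then (if card B = 1 then x else y * perm_weight x y {1..card B}) *
            perm_weight x y {1..n - card B} else 0)"
      using smaller[of B] smaller[of "S - B"] by auto
  qed
  also have "\<dots> = (\<Sum>k\<le>n. of_nat (n choose k) * (if odd k
       then (if k = 1 then x else y * perm_weight x y {1..k}) * perm_weight x y {1..n - k}
       else 0))"
    unfolding assms(2)[symmetric] using assms(1) by (rule sum_Pow_card)
  finally show ?thesis using False assms(1,2) by auto
qed

text \<open>
  The sets \<open>S\<close> and \<open>{1..card S}\<close> obey the same recurrence, so induction replaces
  the transport of lists along an order isomorphism.
\<close>
lemma perm_weight_depends_on_card:
  fixes x y :: "'a::comm_semiring_1"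
  assumes "finite S" "0 \<notin> S"
  shows "perm_weight x y S = perm_weight x y {1..card S}"
  using assms
proof (induction "card S" arbitrary: S rule: less_induct)
  case less
  show ?case
  proof (cases "S = {}")
    case False
    define m where "m = Min S"
    define S' where "S' = S - {m}"
    have m: "m \<in> S" "\<forall>a\<in>S'. m < a"
      using less.prems False by (auto simp: m_def S'_def order_less_le)
    have S: "S = insert m S'" using m by (auto simp: S'_def)
    have S': "finite S'" "m \<notin> S'" "0 < m" "0 \<notin> S'"
      using less.prems m by (auto simp: S'_def intro: gr0I)
    have card: "card S = Suc (card S')" using S S' by simp
    let ?R = "{2..Suc (card S')}"
    have R: "{1..card S} = insert 1 ?R" "card ?R = card S'" using card by auto
    have IH: "perm_weight x y B = perm_weight x y {1..card B}"
      if "finite B" "card B \<le> card S'" "0 \<notin> B" for B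
      using less.hyps[of B] that card by simp
    have sub: "perm_weight x y B = perm_weight x y {1..card B}"
      if "B \<subseteq> T" "finite T" "card T = card S'" "0 \<notin> T" for B T
      using that by (intro IH) (auto intro: finite_subset simp flip: that(3) intro!: card_mono)
    have "perm_weight x y S = perm_weight x y (insert 1 ?R)"
      using perm_weight_insert_min_card[OF S'(1) refl S'(3) m(2) sub[OF _ S'(1) refl S'(4)]]
        perm_weight_insert_min_card[OF _ R(2) _ _ sub[of _ ?R], of 1] R(2) S by simp
    then show ?thesis using R by simp
  qed auto
qed

lemma TA_poly_0: "TA_poly 0 x y = 1"
  by (simp add: TA_poly_eq_perm_weight perm_weight_def)

lemma TA_poly_Suc:
  fixes x y :: "'a::comm_semiring_1"
  shows "TA_poly (Suc n) x y = (if n = 0 then 1 else 0) +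
    (\<Sum>k\<le>n. of_nat (n choose k) * (if odd k
       then (if k = 1 then x else y * TA_poly k x y) * TA_poly (n - k) x y else 0))"
proof -
  have *: "{1..Suc n} = insert 1 {2..Suc n}" by auto
  have "perm_weight x y B = perm_weight x y {1..card B}" if "B \<subseteq> {2..Suc n}" for B
    using that by (intro perm_weight_depends_on_card) (auto intro: finite_subset)
  then show ?thesis
    unfolding TA_poly_eq_perm_weight *
    by (intro perm_weight_insert_min_card) auto
qed

section \<open>The differential equations of the generating functions\<close>

definition TA_even_egf :: "'a \<Rightarrow> 'a \<Rightarrow> 'a::field_char_0 fps" where
  "TA_even_egf x y = Abs_fps (\<lambda>n. if even n then TA_poly n x y / fact n else 0)"

definition TA_odd_egf :: "'a \<Rightarrow> 'a \<Rightarrow> 'a::field_char_0 fps" where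
  "TA_odd_egf x y = Abs_fps (\<lambda>n. if odd n then TA_poly n x y / fact n else 0)"

lemma TA_egf_even_plus_odd:
  "Abs_fps (\<lambda>n. TA_poly n x y / fact n) = TA_even_egf x y + TA_odd_egf x y"
  by (simp add: fps_eq_iff TA_even_egf_def TA_odd_egf_def)

text \<open>
  The coefficients of $D = (x - y) t + y O$ are $y\,T_k / k!$ for odd $k$, except that the linear
  one is $x$, because $T_1 = 1$: the summand $(x - y) t$ corrects the weight of a single-entry
  block from $y$ to $x$.
\<close>
lemma TA_poly_Suc_over_fact:
  fixes x y :: "'a::field_char_0"
  defines "D \<equiv> fps_const (x - y) * fps_X + fps_const y * TA_odd_egf x y"
  shows "TA_poly (Suc n) x y / fact n =
    (if n = 0 then 1 else 0) + (\<Sum>k\<le>n. D $ k * (TA_poly (n - k) x y / fact (n - k)))"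
    and "even k \<Longrightarrow> D $ k = 0"
proof -
  have "TA_poly (Suc 0) x y = 1" by (subst TA_poly_Suc) simp
  then have D: "D $ k = (if odd k then (if k = 1 then x else y * TA_poly k x y) / fact k else 0)" for k
    by (auto simp: D_def TA_odd_egf_def fps_X_def)
  then show "even k \<Longrightarrow> D $ k = 0" by simp
  have "TA_poly (Suc n) x y / fact n = (if n = 0 then 1 else 0) +
    (\<Sum>k\<le>n. of_nat (n choose k) * (if odd k
       then (if k = 1 then x else y * TA_poly k x y) * TA_poly (n - k) x y else 0) / fact n)"
    by (simp add: TA_poly_Suc add_divide_distrib sum_divide_distrib)
  also have "(\<Sum>k\<le>n. of_nat (n choose k) * (if odd k
       then (if k = 1 then x else y * TA_poly k x y) * TA_poly (n - k) x y else 0) / fact n) =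
    (\<Sum>k\<le>n. D $ k * (TA_poly (n - k) x y / fact (n - k)))"
    by (intro sum.cong refl) (auto simp: D binomial_fact)
  finally show "TA_poly (Suc n) x y / fact n =
    (if n = 0 then 1 else 0) + (\<Sum>k\<le>n. D $ k * (TA_poly (n - k) x y / fact (n - k)))" .
qed

text \<open>
  As \<open>D\<close> is odd in $t$, multiplying by it exchanges parities; so the recurrence for all
  coefficients splits into one equation for each part.
\<close>
lemma TA_egf_ode:
  fixes x y :: "'a::field_char_0"
  defines "D \<equiv> fps_const (x - y) * fps_X + fps_const y * TA_odd_egf x y"
  shows "fps_deriv (TA_odd_egf x y) = 1 + D * TA_odd_egf x y"
    and "fps_deriv (TA_even_egf x y) = D * TA_even_egf x y"
proof -
  note step = TA_poly_Suc_over_fact[of _ x y, folded D_def]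
  have fact: "of_nat (Suc n) * (TA_poly (Suc n) x y / fact (Suc n)) = TA_poly (Suc n) x y / fact n" for n
    by (simp add: divide_simps del: of_nat_Suc)
  show "fps_deriv (TA_odd_egf x y) = 1 + D * TA_odd_egf x y"
  proof (rule fps_ext)
    fix n
    show "fps_deriv (TA_odd_egf x y) $ n = (1 + D * TA_odd_egf x y) $ n"
    proof (cases "even n")
      case True
      then have "fps_deriv (TA_odd_egf x y) $ n = TA_poly (Suc n) x y / fact n"
        using fact[of n] by (simp add: TA_odd_egf_def del: of_nat_Suc fact_Suc)
      also have "\<dots> = (if n = 0 then 1 else 0) + (\<Sum>k\<le>n. D $ k * TA_odd_egf x y $ (n - k))"
        unfolding step(1) using True step(2)
        by (intro arg_cong2[of _ _ _ _ "(+)"] refl sum.cong) (auto simp: TA_odd_egf_def)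
      finally show ?thesis by (simp add: fps_mult_nth atMost_atLeast0)
    next
      case False
      then have "D $ k * TA_odd_egf x y $ (n - k) = 0" if "k \<le> n" for k
        using step(2)[of k] that by (cases "even k") (auto simp: TA_odd_egf_def)
      then have "(\<Sum>k=0..n. D $ k * TA_odd_egf x y $ (n - k)) = 0"
        by (intro sum.neutral) auto
      moreover have "n \<noteq> 0" using False by (metis even_zero)
      \<comment> \<open>Only the series under the derivative is unfolded, so that the vanishing sum still matches.\<close>
      ultimately show ?thesis using False by (simp add: TA_odd_egf_def[THEN arg_cong[of _ _ fps_deriv]] fps_mult_nth)
    qed
  qed
  show "fps_deriv (TA_even_egf x y) = D * TA_even_egf x y"
  proof (rule fps_ext)
    fix n
    show "fps_deriv (TA_even_egf x y) $ n = (D * TA_even_egf x y) $ n"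
    proof (cases "odd n")
      case True
      then have "fps_deriv (TA_even_egf x y) $ n = TA_poly (Suc n) x y / fact n"
        using fact[of n] by (simp add: TA_even_egf_def del: of_nat_Suc fact_Suc)
      also have "\<dots> = (if n = 0 then 1 else 0) + (\<Sum>k\<le>n. D $ k * TA_even_egf x y $ (n - k))"
        unfolding step(1) using True step(2)
        by (intro arg_cong2[of _ _ _ _ "(+)"] refl sum.cong) (auto simp: TA_even_egf_def)
      finally show ?thesis using True by (auto simp: fps_mult_nth atMost_atLeast0 odd_pos)
    next
      case False
      then have "D $ k * TA_even_egf x y $ (n - k) = 0" if "k \<le> n" for k
        using step(2)[of k] that by (cases "even k") (auto simp: TA_even_egf_def)
      then have "(\<Sum>k=0..n. D $ k * TA_even_egf x y $ (n - k)) = 0"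
        by (intro sum.neutral) auto
      then show ?thesis using False by (auto simp: TA_even_egf_def[THEN arg_cong[of _ _ fps_deriv]] fps_mult_nth)
    qed
  qed
qed

section \<open>Power series solutions of linear differential equations\<close>

lemma fps_linear_ode_unique:
  fixes F :: "'a::field_char_0 fps"
  assumes "fps_deriv F = P * F" "F $ 0 = 0"
  shows "F = 0"
proof (rule fps_ext)
  fix n show "F $ n = 0 $ n"
  proof (induction n rule: less_induct)
    case (less n)
    show ?case
    proof (cases n)
      case (Suc m)
      have "of_nat (Suc m) * F $ Suc m = (P * F) $ m"
        using arg_cong[OF assms(1), of "\<lambda>G. G $ m"] by simp
      also have "\<dots> = 0"
        using less Suc unfolding fps_mult_nth by (intro sum.neutral) auto
      finally show ?thesis using Suc by (simp del: of_nat_Suc)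
    qed (use assms in simp)
  qed
qed

lemma fps_linear_ode2_unique:
  fixes F :: "'a::field_char_0 fps"
  assumes "fps_deriv (fps_deriv F) = P * fps_deriv F + Q * F" "F $ 0 = 0" "F $ 1 = 0"
  shows "F = 0"
proof (rule fps_ext)
  fix n show "F $ n = 0 $ n"
  proof (induction n rule: less_induct)
    case (less n)
    consider "n = 0" | "n = 1" | m where "n = Suc (Suc m)"
      by (metis One_nat_def not0_implies_Suc)
    then show ?case
    proof cases
      case 3
      have "of_nat (Suc m) * (of_nat (Suc (Suc m)) * F $ Suc (Suc m)) =
          (P * fps_deriv F + Q * F) $ m"
        using arg_cong[OF assms(1), of "\<lambda>G. G $ m"] by (simp del: of_nat_Suc)
      also have "\<dots> = 0"
        unfolding fps_add_nth fps_mult_nth using less 3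
        by (auto simp: sum.neutral)
      finally show ?thesis using 3 by (simp del: of_nat_Suc)
    qed (use assms in simp_all)
  qed
qed

section \<open>Differential equations for confluent hypergeometric series\<close>

lemma fps_compose_const_X2_nth:
  fixes F :: "'a::comm_ring_1 fps"
  shows "(F oo (fps_const c * fps_X ^ 2)) $ n = (if even n then F $ (n div 2) * c ^ (n div 2) else 0)"
proof -
  have "(F oo (fps_const c * fps_X ^ 2)) $ n =
      (\<Sum>i=0..n. if n = 2 * i then F $ i * c ^ i else 0)"
    unfolding fps_compose_nth
    by (intro sum.cong refl)
       (auto simp: power_mult_distrib fps_const_power power_mult[symmetric] fps_X_power_nth
             simp del: power_mult)
  also have "\<dots> = (\<Sum>i\<in>{i. 2 * i = n}. F $ i * c ^ i)"
    by (rule sum.mono_neutral_cong_right) auto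
  also have "\<dots> = (if even n then F $ (n div 2) * c ^ (n div 2) else 0)"
  proof (cases "even n")
    case True
    then have "{i. 2 * i = n} = {n div 2}" by auto
    then show ?thesis using True by simp
  next
    case False
    then have "{i. 2 * i = n} = {}" by auto
    then show ?thesis using False by simp
  qed
  finally show ?thesis .
qed

text \<open>This keeps the denominators of the series with parameters $1/2$ and $3/2$ from vanishing.\<close>
lemma pochhammer_half_nonzero:
  assumes "0 < m"
  shows "pochhammer (of_nat m / 2 :: 'a::field_char_0) k \<noteq> 0"
proof
  assume "pochhammer (of_nat m / 2 :: 'a) k = 0"
  then obtain j where "of_nat m / 2 = (- of_nat j :: 'a)" by (auto simp: pochhammer_eq_0_iff)
  then have "of_nat (m + 2 * j) = (0 :: 'a)" by (simp add: field_simps eq_neg_iff_add_eq_0)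
  then show False using assms by (simp only: of_nat_eq_0_iff)
qed

lemma hypergeo_coeff_Suc:
  fixes a b c :: "'a::field_char_0"
  assumes "pochhammer b (Suc k) \<noteq> 0"
  shows "of_nat (Suc k) * ((b + of_nat k) *
      (pochhammer a (Suc k) / pochhammer b (Suc k) / fact (Suc k) * c ^ Suc k)) =
    c * (a + of_nat k) * (pochhammer a k / pochhammer b k / fact k * c ^ k)"
proof -
  define s where "s = (of_nat (Suc k) :: 'a)"
  have "s \<noteq> 0" unfolding s_def by (rule of_nat_neq_0)
  moreover have "pochhammer b k \<noteq> 0" "b + of_nat k \<noteq> 0"
    using assms by (auto simp: pochhammer_Suc)
  ultimately show ?thesis
    unfolding pochhammer_Suc fact_Suc s_def[symmetric] by (simp add: divide_simps)
qed

text \<open>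
  The coefficient of $t^{2k+2}$ acquires the factor $(2k+1)(2k+2) = 4 (k + 1/2)(k+1)$ under two
  derivatives, which cancels the denominators of the term ratio and leaves $4 c (a + k)$.
\<close>
lemma hypergeo_1F1_half_ode:
  fixes a c :: "'a::field_char_0"
  defines "U \<equiv> hypergeo_1F1 a (1 / 2) (fps_const c * fps_X ^ 2)"
  shows "fps_deriv (fps_deriv U) = fps_const (2 * c) * fps_X * fps_deriv U + fps_const (4 * c * a) * U"
proof (rule fps_ext)
  fix n
  have U: "U $ n = (if even n then pochhammer a (n div 2) / pochhammer (1 / 2) (n div 2) /
      fact (n div 2) * c ^ (n div 2) else 0)" for n
    by (simp add: U_def hypergeo_1F1_series fps_compose_const_X2_nth)
  have "of_nat (Suc n) * (of_nat (Suc (Suc n)) * U $ Suc (Suc n)) =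
      2 * c * (of_nat n * U $ n) + 4 * c * a * U $ n"
  proof (cases "even n")
    case True
    then obtain k where n: "n = 2 * k" by auto
    have "of_nat (Suc n) * (of_nat (Suc (Suc n)) * U $ Suc (Suc n)) =
        4 * (of_nat (Suc k) * ((1 / 2 + of_nat k) * U $ Suc (Suc n)))"
      by (simp add: n algebra_simps)
    also have "of_nat (Suc k) * ((1 / 2 + of_nat k) * U $ Suc (Suc n)) = c * (a + of_nat k) * U $ n"
    proof -
      have "pochhammer (1 / 2 :: 'a) (Suc k) \<noteq> 0"
        using pochhammer_half_nonzero[of 1 "Suc k", where 'a = 'a] by simp
      from hypergeo_coeff_Suc[OF this, of a c]
      show ?thesis by (simp add: U n del: power_Suc fact_Suc of_nat_Suc)
    qed
    finally show ?thesis by (simp add: n algebra_simps)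
  qed (simp add: U)
  then show "fps_deriv (fps_deriv U) $ n =
      (fps_const (2 * c) * fps_X * fps_deriv U + fps_const (4 * c * a) * U) $ n"
    by (simp add: mult.assoc fps_mult_fps_X_deriv_shift del: of_nat_Suc)
qed

text \<open>
  The same for the odd series, with the factor $(2k+2)(2k+3) = 4 (k + 1)(k + 3/2)$. What remains is
  $4 c (b + k) = 2 c (2 k + 1) + (4 c b - 2 c)$.
\<close>
lemma X_hypergeo_1F1_three_halves_ode:
  fixes b c :: "'a::field_char_0"
  defines "V \<equiv> fps_X * hypergeo_1F1 b (3 / 2) (fps_const c * fps_X ^ 2)"
  shows "fps_deriv (fps_deriv V) =
    fps_const (2 * c) * fps_X * fps_deriv V + fps_const (4 * c * b - 2 * c) * V"
proof (rule fps_ext)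
  fix n
  have V: "V $ n = (if odd n then pochhammer b (n div 2) / pochhammer (3 / 2) (n div 2) /
      fact (n div 2) * c ^ (n div 2) else 0)" for n
    by (cases n) (auto simp: V_def hypergeo_1F1_series fps_compose_const_X2_nth)
  have "of_nat (Suc n) * (of_nat (Suc (Suc n)) * V $ Suc (Suc n)) =
      2 * c * (of_nat n * V $ n) + (4 * c * b - 2 * c) * V $ n"
  proof (cases "odd n")
    case True
    then obtain k where n: "n = Suc (2 * k)" by (auto elim: oddE)
    have "of_nat (Suc n) * (of_nat (Suc (Suc n)) * V $ Suc (Suc n)) =
        4 * (of_nat (Suc k) * ((3 / 2 + of_nat k) * V $ Suc (Suc n)))"
      by (simp add: n algebra_simps)
    also have "of_nat (Suc k) * ((3 / 2 + of_nat k) * V $ Suc (Suc n)) = c * (b + of_nat k) * V $ n"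
    proof -
      have "pochhammer (3 / 2 :: 'a) (Suc k) \<noteq> 0"
        using pochhammer_half_nonzero[of 3 "Suc k", where 'a = 'a] by simp
      from hypergeo_coeff_Suc[OF this, of b c]
      show ?thesis by (simp add: V n del: power_Suc fact_Suc of_nat_Suc)
    qed
    finally show ?thesis by (simp add: n algebra_simps)
  qed (simp add: V)
  then show "fps_deriv (fps_deriv V) $ n =
      (fps_const (2 * c) * fps_X * fps_deriv V + fps_const (4 * c * b - 2 * c) * V) $ n"
    by (simp add: mult.assoc fps_mult_fps_X_deriv_shift del: of_nat_Suc)
qed

lemma exp_fps_X2_deriv:
  fixes c :: "'a::field_char_0"
  shows "fps_deriv (exp_fps (fps_const c * fps_X ^ 2)) =
    fps_const (2 * c) * fps_X * exp_fps (fps_const c * fps_X ^ 2)"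
proof -
  have "fps_deriv (fps_const c * fps_X ^ 2) = fps_const (2 * c) * fps_X"
    by (simp add: fps_deriv_power' power2_eq_square numeral_fps_const)
  moreover have "(fps_const c * fps_X ^ 2) $ 0 = 0" by simp
  ultimately show ?thesis unfolding exp_fps_def by (simp add: fps_compose_deriv mult.commute)
qed

section \<open>Solving the Riccati equation\<close>

text \<open>
  Distinctness of $x$ and $y$ gives a meaning to the hypergeometric parameters, whose denominators
  are $2 (x - y)$.
\<close>
lemma TA_egf_closed_form:
  fixes x y :: "'a::field_char_0"
  assumes "x \<noteq> y"
  shows "Abs_fps (\<lambda>n. TA_poly n x y / fact n) =
    exp_fps (fps_const ((x - y) / 2) * fps_X ^ 2) *
      (1 + fps_X * hypergeo_1F1 (x / (2 * (x - y))) (3 / 2)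
                     (- (fps_const ((x - y) / 2) * fps_X ^ 2))) /
    hypergeo_1F1 (- y / (2 * (x - y))) (1 / 2)
      (fps_const ((x - y) / 2) * fps_X ^ 2)"
proof -
  define d where "d = x - y"
  have "d \<noteq> 0" using assms by (simp add: d_def)
  define K where "K = exp_fps (fps_const (d / 2) * fps_X ^ 2)"
  define N where "N = fps_X * hypergeo_1F1 (x / (2 * d)) (3 / 2) (fps_const (- d / 2) * fps_X ^ 2)"
  define H where "H = hypergeo_1F1 (- y / (2 * d)) (1 / 2) (fps_const (d / 2) * fps_X ^ 2)"
  define Y where "Y = fps_const y"
  define L where "L = fps_const d * fps_X"
  have K: "fps_deriv K = L * K" "K $ 0 = 1"
    using exp_fps_X2_deriv[of "d / 2"] by (simp_all add: K_def L_def exp_fps_def)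
  have N: "fps_deriv (fps_deriv N) = - L * fps_deriv N - Y * N"
  proof -
    have x: "x = y + d" by (simp add: d_def)
    have "4 * (- d / 2) * (x / (2 * d)) - 2 * (- d / 2) = - y" "2 * (- d / 2) = - d"
      unfolding x using \<open>d \<noteq> 0\<close> by (simp_all add: field_simps)
    then show ?thesis
      using X_hypergeo_1F1_three_halves_ode[of "x / (2 * d)" "- d / 2", folded N_def]
      unfolding L_def Y_def
      by (simp only: fps_const_neg[symmetric] mult_minus_left diff_conv_add_uminus)
  qed
  have N0: "N $ 0 = 0" "N $ 1 = 1"
    by (simp_all add: N_def hypergeo_1F1_series)
  have H: "fps_deriv (fps_deriv H) = L * fps_deriv H - Y * H"
  proof -
    have "4 * (d / 2) * (- y / (2 * d)) = - y" "2 * (d / 2) = d"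
      using \<open>d \<noteq> 0\<close> by simp_all
    then show ?thesis
      using hypergeo_1F1_half_ode[of "- y / (2 * d)" "d / 2", folded H_def]
      unfolding L_def Y_def
      by (simp only: fps_const_neg[symmetric] mult_minus_left diff_conv_add_uminus)
  qed
  have H0: "H $ 0 = 1" "H $ 1 = 0"
    by (simp_all add: H_def hypergeo_1F1_series fps_compose_const_X2_nth)
  \<comment> \<open>Kummer's transformation in the form \<open>H = K * fps_deriv N\<close>: both sides solve
    the same second-order equation with the same initial values.\<close>
  define W where "W = K * fps_deriv N"
  have KN: "fps_deriv (K * N) = L * (K * N) + W"
    by (simp add: K W_def algebra_simps)
  have W: "fps_deriv W = - Y * (K * N)"
    by (simp add: W_def K N algebra_simps)
  have W2: "fps_deriv (fps_deriv W) = L * fps_deriv W - Y * W"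
  proof -
    have DY: "fps_deriv (Y * G) = Y * fps_deriv G" for G by (simp add: Y_def)
    show ?thesis unfolding W mult_minus_left fps_deriv_neg DY KN by (simp add: algebra_simps)
  qed
  have "H - W = 0"
  proof (rule fps_linear_ode2_unique)
    show "fps_deriv (fps_deriv (H - W)) = L * fps_deriv (H - W) + (- Y) * (H - W)"
      by (simp add: H W2 algebra_simps)
    show "(H - W) $ 0 = 0" using K(2) N0 H0 by (simp add: W_def)
    have "W $ 1 = fps_deriv W $ 0" by simp
    also have "\<dots> = 0" unfolding W using N0 by simp
    finally show "(H - W) $ 1 = 0" using H0 by simp
  qed
  then have HW: "H = W" by simp
  have "H \<noteq> 0" using H0 by auto
  \<comment> \<open>The candidates for the odd and the even part. Their equations are obtained from
    \<open>H * Od = K * N\<close> and \<open>H * Ev = K\<close> by differentiating and cancelling \<open>H\<close>.\<close>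
  define Od Ev where "Od = K * N / H" and "Ev = K / H"
  have Od: "H * Od = K * N" "Od $ 0 = 0" and Ev: "H * Ev = K" "Ev $ 0 = 1"
    using H0 K(2) N0 by (simp_all add: Od_def Ev_def fps_divide_unit inverse_mult_eq_1' mult_ac)
  have H': "fps_deriv H = - Y * (H * Od)" unfolding Od(1) using W HW by simp
  have Od': "fps_deriv Od = 1 + (L + Y * Od) * Od"
  proof -
    have "fps_deriv (H * Od) = L * (H * Od) + H"
      unfolding Od(1) KN using HW by simp
    then have "H * fps_deriv Od + fps_deriv H * Od = L * (H * Od) + H"
      by (simp add: algebra_simps)
    then have "H * fps_deriv Od = H * (1 + (L + Y * Od) * Od)"
      unfolding H' by (simp add: algebra_simps)
    then show ?thesis using \<open>H \<noteq> 0\<close> by simp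
  qed
  have Ev': "fps_deriv Ev = (L + Y * Od) * Ev"
  proof -
    have "fps_deriv (H * Ev) = L * (H * Ev)"
      unfolding Ev(1) by (rule K(1))
    then have "H * fps_deriv Ev + fps_deriv H * Ev = L * (H * Ev)"
      by (simp add: algebra_simps)
    then have "H * fps_deriv Ev = H * ((L + Y * Od) * Ev)"
      unfolding H' by (simp add: algebra_simps)
    then show ?thesis using \<open>H \<noteq> 0\<close> by simp
  qed
  note ode = TA_egf_ode[of x y, folded d_def, folded L_def Y_def]
  \<comment> \<open>The difference of two solutions of the Riccati equation solves a homogeneous linear
    equation whose coefficient involves their sum.\<close>
  have "TA_odd_egf x y - Od = 0"
  proof (rule fps_linear_ode_unique)
    show "fps_deriv (TA_odd_egf x y - Od) =
        (L + Y * (TA_odd_egf x y + Od)) * (TA_odd_egf x y - Od)"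
      by (simp add: ode Od' algebra_simps)
    show "(TA_odd_egf x y - Od) $ 0 = 0" using Od by (simp add: TA_odd_egf_def)
  qed
  then have odd: "TA_odd_egf x y = Od" by simp
  have "TA_even_egf x y - Ev = 0"
  proof (rule fps_linear_ode_unique)
    show "fps_deriv (TA_even_egf x y - Ev) = (L + Y * Od) * (TA_even_egf x y - Ev)"
      by (simp add: ode Ev' odd algebra_simps)
    show "(TA_even_egf x y - Ev) $ 0 = 0" using Ev by (simp add: TA_even_egf_def TA_poly_0)
  qed
  then have even: "TA_even_egf x y = Ev" by simp
  have neg: "- (fps_const (d / 2) * fps_X ^ 2) = fps_const (- d / 2) * fps_X ^ 2"
    by (simp flip: fps_const_neg)
  have "Ev + Od = K * (1 + N) / H"
    using H0 by (simp add: Ev_def Od_def fps_divide_unit algebra_simps)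
  then show ?thesis
    unfolding TA_egf_even_plus_odd odd even K_def N_def H_def d_def[symmetric] neg .
qed

theorem theorem1p10:
  shows "Abs_fps (\<lambda>n. TA_poly n var_x var_y / fact n) =
    exp_fps (fps_const ((var_x - var_y) / 2) * fps_X ^ 2) *
      (1 + fps_X * hypergeo_1F1 (var_x / (2 * (var_x - var_y))) (3 / 2)
                     (- (fps_const ((var_x - var_y) / 2) * fps_X ^ 2))) /
    hypergeo_1F1 (- var_y / (2 * (var_x - var_y))) (1 / 2)
      (fps_const ((var_x - var_y) / 2) * fps_X ^ 2)"
proof (rule TA_egf_closed_form)
  show "var_x \<noteq> var_y" by (simp add: var_x_def var_y_def)
qed

end
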